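(* Let $R$ be a Lie conformal superalgebra with $\lambda$-bracket $[\cdot_\lambda\cdot]$, $M$ a conformal module of $R$, and $\rho:r\mapsto\rho(r)_\lambda$ the corresponding representation. Let $\theta\in\mathbb{Z}_2$ and let $$d_\lambda=\begin{pmatrix} d_{11}&d_{12}\\ d_{21}&d_{22}\end{pmatrix}_\lambda: R\oplus M\to\mathbb{C}[\lambda]\otimes(R\oplus M)$$ be a conformal linear map of degree $\theta$, with components ${d_{11}}_\lambda:R\to\mathbb{C}[\lambda]\otimes R$, ${d_{12}}_\lambda:M\to\mathbb{C}[\lambda]\otimes R$, ${d_{21}}_\lambda:R\to\mathbb{C}[\lambda]\otimes M$, ${d_{22}}_\lambda:M\to\mathbb{C}[\lambda]\otimes M$. Then $d_\lambda$ is a conformal derivation of degree $\theta$ of the semidirect product $R\ltimes M$ if and only if the following conditions hold: (1) $d_{11}$ is a conformal derivation of degree $\theta$ of $R$. (2) For any $r\in R$ and $m,m'\in M$, $${d_{12}}_\lambda(\rho(r)_\mu m)=(-1)^{\theta|r|}[r_\mu({d_{12}}_\lambda m)],\qquad \rho({d_{12}}_\lambda m)_{\lambda+\mu}(m')=(-1)^{|m||m'|}\rho({d_{12}}_\lambda m')_{-\partial-\mu}(m).$$ (3) $d_{21}$ is a conformal derivation of degree $\theta$ from $R$ to $M$. (4) For any $r\in R$ and $m\in M$, $${d_{22}}_\lambda(\rho(r)_\mu m)=\rho({d_{11}}_\lambda r)_{\lambda+\mu}(m)+(-1)^{\theta|r|}\rho(r)_\mu({d_{22}}_\lambda m).$$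
   Context: Everything is over $\mathbb{C}$. Degrees $|a|$ lie in $\mathbb{Z}_2$; whenever $|a|$ occurs, $a$ is homogeneous, and formulas are extended linearly. All $\mathbb{Z}_2$-graded $\mathbb{C}[\partial]$-modules are finitely generated. A Lie conformal superalgebra is a $\mathbb{Z}_2$-graded $\mathbb{C}[\partial]$-module $R=R_{\bar0}\oplus R_{\bar1}$ with a $\mathbb{C}$-bilinear map $R\times R\to R[\lambda]$, $(a,b)\mapsto[a_\lambda b]$, compatible with the grading, such that (C1) $[(\partial a)_\lambda b]=-\lambda[a_\lambda b]$; (C2) $[a_\lambda b]=-(-1)^{|a||b|}[b_{-\partial-\lambda}a]$; (C3) $[a_\lambda[b_\mu c]]=[[a_\lambda b]_{\lambda+\mu}c]+(-1)^{|a||b|}[b_\mu[a_\lambda c]]$. Brackets and maps are extended linearly over polynomials in the formal variables. An expression with subscript involving $-\partial$, e.g. $[b_{-\partial-\lambda}a]$ or $\rho(r)_{-\partial-\mu}m$, means: write $[b_\nu a]$ (resp. $\rho(r)_\nu m$) as $\sum_n \nu^n c_n$ and replace $\nu$ by the given expression, with $\partial$ acting on the coefficients $c_n$. A conformal linear map of degree $\theta$ from $M$ to $N$ is a $\mathbb{C}$-linear map $f_\lambda:M\to N[\lambda]$ with $f_\lambda\partial=(\partial+\lambda)f_\lambda$ and $f_\lambda(M_\mu)\subseteq N_{\mu+\theta}[\lambda]$ for $\mu\in\mathbb{Z}_2$; $\mathrm{Chom}(M,N)$ is the sum of the spaces of such maps of degree $\bar0$ and $\bar1$; $\mathrm{Cend}(M)=\mathrm{Chom}(M,M)$.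 A conformal module $M$ of $R$ is a $\mathbb{Z}_2$-graded $\mathbb{C}[\partial]$-module with a representation $\rho:R\to\mathrm{Cend}(M)$, i.e. a degree-preserving linear map with $\rho(\partial a)_\lambda=-\lambda\rho(a)_\lambda$ and $\rho(a)_\lambda\rho(b)_\mu-(-1)^{|a||b|}\rho(b)_\mu\rho(a)_\lambda=\rho([a_\lambda b])_{\lambda+\mu}$. The semidirect product $R\ltimes M$ is $R\oplus M$ with $(R\oplus M)_\theta=R_\theta\oplus M_\theta$ and $[(r+m)_\lambda(r'+m')]=[r_\lambda r']+\rho(r)_\lambda m'-(-1)^{|r'||m|}\rho(r')_{-\partial-\lambda}m$; it is a Lie conformal superalgebra. A conformal derivation of degree $\theta$ of a Lie conformal superalgebra $R$ is a conformal linear map $d:R\to R$ of degree $\theta=|d|$ with $d_\lambda([a_\mu b])=[(d_\lambda(a))_{\lambda+\mu}b]+(-1)^{|a||d|}[a_\mu(d_\lambda(b))]$ for all $a,b\in R$. A conformal derivation of degree $\theta=|d|$ from $R$ to $M$ is a conformal linear map $d:R\to M$ of degree $\theta$ with $d_\lambda([r_\mu r'])=(-1)^{|r||d|}\rho(r)_\mu(d_\lambda(r'))-(-1)^{(|r|+|d|)|r'|}\rho(r')_{-\partial-\lambda-\mu}(d_\lambda(r))$ for all $r,r'\in R$. *)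

theory Defs
  imports
    "HOL-Computational_Algebra.Polynomial"
    "HOL-Library.Z2"
    "HOL-Library.Product_Plus"
begin

text \<open>
  A \<open>\<complex>[\<partial>]\<close>-module is a module over \<^typ>\<open>complex poly\<close>, given by its scalar
  multiplication; \<open>\<partial>\<close> acts as \<open>[:0, 1:]\<close> and \<open>c \<in> \<complex>\<close> as \<open>[:c:]\<close>.  The space \<open>V[\<lambda>]\<close>
  is \<open>'v poly\<close>, and \<open>V[\<lambda>,\<mu>]\<close> is \<open>'v poly poly\<close> with inner variable \<open>\<lambda>\<close> and outer
  variable \<open>\<mu>\<close>.  Degrees live in the two-element field \<^typ>\<open>bit\<close>.
\<close>

text \<open>The action of \<open>K[x]\<close> on \<open>V[x]\<close> induced by an action of \<open>K\<close> on \<open>V\<close>.\<close>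

definition pact ::
    "('k::comm_ring_1 \<Rightarrow> 'v::ab_group_add \<Rightarrow> 'v) \<Rightarrow> 'k poly \<Rightarrow> 'v poly \<Rightarrow> 'v poly" where
  "pact s p f = (\<Sum>i\<le>degree p. \<Sum>j\<le>degree f. monom (s (coeff p i) (coeff f j)) (i + j))"

text \<open>Substitution of a scalar \<open>p\<close> for \<open>\<nu>\<close>: \<open>\<Sum>\<^sub>n \<nu>\<^sup>n c\<^sub>n\<close> becomes \<open>\<Sum>\<^sub>n p\<^sup>n c\<^sub>n\<close>, where \<open>p\<close> acts on
  the coefficients \<open>c\<^sub>n\<close>.\<close>

definition peval ::
    "('k::comm_ring_1 \<Rightarrow> 'v::ab_group_add \<Rightarrow> 'v) \<Rightarrow> 'k \<Rightarrow> 'v poly \<Rightarrow> 'v" where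
  "peval s p f = (\<Sum>n\<le>degree f. s (p ^ n) (coeff f n))"

text \<open>\<open>\<partial>\<close> and \<open>\<lambda>\<close> as elements of \<open>\<complex>[\<partial>][\<lambda>]\<close>; then \<open>\<partial>\<close>, \<open>\<lambda>\<close>, \<open>\<mu>\<close> as elements of
  \<open>\<complex>[\<partial>][\<lambda>][\<mu>]\<close>.\<close>

abbreviation D1 :: "complex poly poly" where "D1 \<equiv> [:[:0, 1:]:]"
abbreviation L1 :: "complex poly poly" where "L1 \<equiv> [:0, 1:]"

abbreviation D2 :: "complex poly poly poly" where "D2 \<equiv> [:D1:]"
abbreviation L2 :: "complex poly poly poly" where "L2 \<equiv> [:L1:]"
abbreviation M2 :: "complex poly poly poly" where "M2 \<equiv> [:0, 1:]"

text \<open>The inclusions of \<open>V[\<lambda>]\<close> and of \<open>V[\<mu>]\<close> into \<open>V[\<lambda>,\<mu>]\<close>.\<close>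

definition in_lam :: "'v::zero poly \<Rightarrow> 'v poly poly" where
  "in_lam f = [:f:]"

definition in_mu :: "'v::zero poly \<Rightarrow> 'v poly poly" where
  "in_mu f = map_poly (\<lambda>c. [:c:]) f"

text \<open>\<open>subst1 s p f\<close> is \<open>f \<in> V[\<nu>]\<close> with \<open>p \<in> \<complex>[\<partial>][\<lambda>]\<close> substituted for \<open>\<nu>\<close>, an element
  of \<open>V[\<lambda>]\<close>.\<close>

definition subst1 ::
    "(complex poly \<Rightarrow> 'v::ab_group_add \<Rightarrow> 'v) \<Rightarrow> complex poly poly \<Rightarrow> 'v poly \<Rightarrow> 'v poly" where
  "subst1 s p f = peval (pact s) p (map_poly (\<lambda>c. [:c:]) f)"

text \<open>\<open>app2 s p f u\<close> is \<open>f\<^sub>p(u)\<close> for \<open>f\<^sub>\<nu> : U \<rightarrow> V[\<nu>]\<close>, \<open>p \<in> \<complex>[\<partial>][\<lambda>][\<mu>]\<close> and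
  \<open>u = \<Sum> u\<^sub>i\<^sub>j \<lambda>\<^sup>i \<mu>\<^sup>j\<close>: the map is extended linearly over \<open>\<lambda>\<close> and \<open>\<mu>\<close>, giving
  \<open>\<Sum> \<lambda>\<^sup>i \<mu>\<^sup>j f\<^sub>p(u\<^sub>i\<^sub>j)\<close>.\<close>

definition app2 ::
    "(complex poly \<Rightarrow> 'v::ab_group_add \<Rightarrow> 'v) \<Rightarrow> complex poly poly poly
      \<Rightarrow> ('u::zero \<Rightarrow> 'v poly) \<Rightarrow> 'u poly poly \<Rightarrow> 'v poly poly" where
  "app2 s p f u =
    (\<Sum>j\<le>degree u. \<Sum>i\<le>degree (coeff u j).
      peval (pact (pact s)) p (map_poly (\<lambda>c. monom (monom c i) j) (f (coeff (coeff u j) i))))"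

text \<open>\<open>ksgn \<epsilon> x\<close> is \<open>(-1)\<^sup>\<epsilon> x\<close>.\<close>

definition ksgn :: "bit \<Rightarrow> 'v::ab_group_add \<Rightarrow> 'v" where
  "ksgn e x = (if e = 1 then - x else x)"

locale graded_module = module scale
  for scale :: "complex poly \<Rightarrow> 'v::ab_group_add \<Rightarrow> 'v" +
  fixes gr :: "bit \<Rightarrow> 'v set"
  assumes finitely_generated: "\<exists>B. finite B \<and> span B = UNIV"
    and gr_subspace: "subspace (gr \<alpha>)"
    and gr_sum: "\<exists>y\<in>gr 0. \<exists>z\<in>gr 1. x = y + z"
    and gr_inter: "gr 0 \<inter> gr 1 = {0}"

text \<open>The homogeneous component of \<open>x\<close> of degree \<open>\<alpha>\<close>; note \<open>\<alpha> + 1\<close> is the other degree.\<close>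

definition hpart :: "(bit \<Rightarrow> 'v::ab_group_add set) \<Rightarrow> bit \<Rightarrow> 'v \<Rightarrow> 'v" where
  "hpart gr \<alpha> x = (THE y. y \<in> gr \<alpha> \<and> x - y \<in> gr (\<alpha> + 1))"

abbreviation clinear_poly ::
    "(complex poly \<Rightarrow> 'u::ab_group_add \<Rightarrow> 'u) \<Rightarrow> (complex poly \<Rightarrow> 'v::ab_group_add \<Rightarrow> 'v)
      \<Rightarrow> ('u \<Rightarrow> 'v poly) \<Rightarrow> bool" where
  "clinear_poly sU sV f \<equiv>
    Vector_Spaces.linear (\<lambda>c. sU [:c:]) (\<lambda>c. pact sV [:[:c:]:]) f"

definition conformal_linear ::
    "(complex poly \<Rightarrow> 'm::ab_group_add \<Rightarrow> 'm) \<Rightarrow> (bit \<Rightarrow> 'm set)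
      \<Rightarrow> (complex poly \<Rightarrow> 'n::ab_group_add \<Rightarrow> 'n) \<Rightarrow> (bit \<Rightarrow> 'n set)
      \<Rightarrow> bit \<Rightarrow> ('m \<Rightarrow> 'n poly) \<Rightarrow> bool" where
  "conformal_linear sM grM sN grN \<theta> f \<longleftrightarrow>
    clinear_poly sM sN f \<and>
    (\<forall>x. f (sM [:0, 1:] x) = pact sN (D1 + L1) (f x)) \<and>
    (\<forall>\<alpha>. \<forall>x\<in>grM \<alpha>. \<forall>n. coeff (f x) n \<in> grN (\<alpha> + \<theta>))"

locale lie_conformal_superalgebra = graded_module scale gr
  for scale :: "complex poly \<Rightarrow> 'r::ab_group_add \<Rightarrow> 'r"
    and gr :: "bit \<Rightarrow> 'r set" +
  fixes br :: "'r \<Rightarrow> 'r \<Rightarrow> 'r poly"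
  assumes br_linear_right: "clinear_poly scale scale (br a)"
    and br_linear_left: "clinear_poly scale scale (\<lambda>a. br a b)"
    and br_graded: "a \<in> gr \<alpha> \<Longrightarrow> b \<in> gr \<beta> \<Longrightarrow> coeff (br a b) n \<in> gr (\<alpha> + \<beta>)"
    and C1: "br (scale [:0, 1:] a) b = pact scale (- L1) (br a b)"
    and C2: "a \<in> gr \<alpha> \<Longrightarrow> b \<in> gr \<beta> \<Longrightarrow>
      br a b = - ksgn (\<alpha> * \<beta>) (subst1 scale (- D1 - L1) (br b a))"
    and C3: "a \<in> gr \<alpha> \<Longrightarrow> b \<in> gr \<beta> \<Longrightarrow>
      app2 scale L2 (br a) (in_mu (br b c)) =
        app2 scale (L2 + M2) (\<lambda>x. br x c) (in_lam (br a b))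
        + ksgn (\<alpha> * \<beta>) (app2 scale M2 (br b) (in_lam (br a c)))"

text \<open>The representation is a degree-preserving linear map \<open>R \<rightarrow> Cend(M)\<close>: since \<open>R\<close> is the
  sum of its homogeneous components, it suffices that \<open>\<rho>\<close> maps each \<open>R\<^sub>\<alpha>\<close> to conformal
  linear maps of degree \<open>\<alpha>\<close>.\<close>

locale conformal_module =
  R: lie_conformal_superalgebra sR grR br + M: graded_module sM grM
  for sR :: "complex poly \<Rightarrow> 'r::ab_group_add \<Rightarrow> 'r"
    and grR :: "bit \<Rightarrow> 'r set"
    and br :: "'r \<Rightarrow> 'r \<Rightarrow> 'r poly"
    and sM :: "complex poly \<Rightarrow> 'm::ab_group_add \<Rightarrow> 'm"
    and grM :: "bit \<Rightarrow> 'm set" +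
  fixes rho :: "'r \<Rightarrow> 'm \<Rightarrow> 'm poly"
  assumes rho_linear: "clinear_poly sR sM (\<lambda>r. rho r m)"
    and rho_graded: "r \<in> grR \<alpha> \<Longrightarrow> conformal_linear sM grM sM grM \<alpha> (rho r)"
    and rho_D: "rho (sR [:0, 1:] r) m = pact sM (- L1) (rho r m)"
    and rho_bracket: "a \<in> grR \<alpha> \<Longrightarrow> b \<in> grR \<beta> \<Longrightarrow>
      app2 sM L2 (rho a) (in_mu (rho b m))
        - ksgn (\<alpha> * \<beta>) (app2 sM M2 (rho b) (in_lam (rho a m))) =
      app2 sM (L2 + M2) (\<lambda>x. rho x m) (in_lam (br a b))"

definition sd_scale ::
    "(complex poly \<Rightarrow> 'r \<Rightarrow> 'r) \<Rightarrow> (complex poly \<Rightarrow> 'm \<Rightarrow> 'm)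
      \<Rightarrow> complex poly \<Rightarrow> 'r \<times> 'm \<Rightarrow> 'r \<times> 'm" where
  "sd_scale sR sM p x = (sR p (fst x), sM p (snd x))"

definition sd_grade ::
    "(bit \<Rightarrow> 'r set) \<Rightarrow> (bit \<Rightarrow> 'm set) \<Rightarrow> bit \<Rightarrow> ('r \<times> 'm) set" where
  "sd_grade grR grM \<theta> = grR \<theta> \<times> grM \<theta>"

text \<open>The last term of the bracket involves \<open>|r'|\<close> and \<open>|m|\<close>, so it is extended linearly from
  the homogeneous components of \<open>r'\<close> and \<open>m\<close>.\<close>

definition sd_bracket ::
    "(bit \<Rightarrow> 'r::ab_group_add set) \<Rightarrow> ('r \<Rightarrow> 'r \<Rightarrow> 'r poly)
      \<Rightarrow> (complex poly \<Rightarrow> 'm::ab_group_add \<Rightarrow> 'm) \<Rightarrow> (bit \<Rightarrow> 'm set)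
      \<Rightarrow> ('r \<Rightarrow> 'm \<Rightarrow> 'm poly) \<Rightarrow> 'r \<times> 'm \<Rightarrow> 'r \<times> 'm \<Rightarrow> ('r \<times> 'm) poly" where
  "sd_bracket grR br sM grM rho x y =
    map_poly (\<lambda>r. (r, 0)) (br (fst x) (fst y)) +
    map_poly (\<lambda>m. (0, m))
      (rho (fst x) (snd y) -
        (\<Sum>\<alpha>\<in>{0, 1}. \<Sum>\<beta>\<in>{0, 1}. ksgn (\<alpha> * \<beta>)
          (subst1 sM (- D1 - L1) (rho (hpart grR \<alpha> (fst y)) (hpart grM \<beta> (snd x))))))"

definition conformal_derivation ::
    "(complex poly \<Rightarrow> 'r::ab_group_add \<Rightarrow> 'r) \<Rightarrow> (bit \<Rightarrow> 'r set) \<Rightarrow> ('r \<Rightarrow> 'r \<Rightarrow> 'r poly)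
      \<Rightarrow> bit \<Rightarrow> ('r \<Rightarrow> 'r poly) \<Rightarrow> bool" where
  "conformal_derivation s gr br \<theta> d \<longleftrightarrow>
    conformal_linear s gr s gr \<theta> d \<and>
    (\<forall>\<alpha>. \<forall>a\<in>gr \<alpha>. \<forall>b.
      app2 s L2 d (in_mu (br a b)) =
        app2 s (L2 + M2) (\<lambda>x. br x b) (in_lam (d a))
        + ksgn (\<alpha> * \<theta>) (app2 s M2 (br a) (in_lam (d b))))"

definition conformal_derivation_into ::
    "(complex poly \<Rightarrow> 'r::ab_group_add \<Rightarrow> 'r) \<Rightarrow> (bit \<Rightarrow> 'r set) \<Rightarrow> ('r \<Rightarrow> 'r \<Rightarrow> 'r poly)
      \<Rightarrow> (complex poly \<Rightarrow> 'm::ab_group_add \<Rightarrow> 'm) \<Rightarrow> (bit \<Rightarrow> 'm set) \<Rightarrow> ('r \<Rightarrow> 'm \<Rightarrow> 'm poly)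
      \<Rightarrow> bit \<Rightarrow> ('r \<Rightarrow> 'm poly) \<Rightarrow> bool" where
  "conformal_derivation_into sR grR br sM grM rho \<theta> d \<longleftrightarrow>
    conformal_linear sR grR sM grM \<theta> d \<and>
    (\<forall>\<alpha> \<beta>. \<forall>r\<in>grR \<alpha>. \<forall>r'\<in>grR \<beta>.
      app2 sM L2 d (in_mu (br r r')) =
        ksgn (\<alpha> * \<theta>) (app2 sM M2 (rho r) (in_lam (d r')))
        - ksgn ((\<alpha> + \<theta>) * \<beta>) (app2 sM (- D2 - L2 - M2) (rho r') (in_lam (d r))))"

definition d11 :: "('r::zero \<times> 'm::zero \<Rightarrow> ('r \<times> 'm) poly) \<Rightarrow> 'r \<Rightarrow> 'r poly" where
  "d11 d r = map_poly fst (d (r, 0))"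

definition d12 :: "('r::zero \<times> 'm::zero \<Rightarrow> ('r \<times> 'm) poly) \<Rightarrow> 'm \<Rightarrow> 'r poly" where
  "d12 d m = map_poly fst (d (0, m))"

definition d21 :: "('r::zero \<times> 'm::zero \<Rightarrow> ('r \<times> 'm) poly) \<Rightarrow> 'r \<Rightarrow> 'm poly" where
  "d21 d r = map_poly snd (d (r, 0))"

definition d22 :: "('r::zero \<times> 'm::zero \<Rightarrow> ('r \<times> 'm) poly) \<Rightarrow> 'm \<Rightarrow> 'm poly" where
  "d22 d m = map_poly snd (d (0, m))"

end

theory Submission
  imports Defs
begin

text \<open>
  Evaluate the derivation identity on pairs from \<open>R \<union> M\<close> and split it into its \<open>R\<close>- and
  \<open>M\<close>-components: pairs in \<open>R \<times> R\<close> give (1) and (3), pairs in \<open>R \<times> M\<close> give the first half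
  of (2) and (4), and pairs in \<open>M \<times> M\<close> give the second half of (2).  The pairs in \<open>M \<times> R\<close> add
  nothing: by skew-symmetry, substituting \<open>-\<partial> - \<lambda> - \<mu>\<close> for \<open>\<mu>\<close> turns the identity for \<open>(b, a)\<close>
  into the one for \<open>(a, b)\<close>.
\<close>

text \<open>The definitions express substitution by sums cut off at degrees, and composing such sums
  directly would mean tracking degrees. In Horner form an additive map that turns the action of
  \<open>p\<close> into the action of \<open>q\<close> passes through the substitution and replaces
  \<open>p\<close> by \<open>q\<close> (\<open>horner_commute\<close>). Every composite of
  substitutions below then reduces to checking how a map treats \<partial>, \<lambda> and \<mu>. The
  delicate point of the skew-symmetry argument is that \<partial> does not commute with
  \<open>d\<close>. By skew-symmetry -\<partial> - \<mu> stands inside the argument of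
  \<open>d\<close>, while -\<partial> - \<lambda> - \<mu> is wanted outside; the rule that
  \<open>d\<close> turns \<partial> into \<partial> + \<lambda> accounts for exactly this shift. The
  other obstacle is that the bracket on R + M carries signs of homogeneous components, whereas the
  second argument of a derivation identity is arbitrary. Biadditivity reduces the identity to
  homogeneous pieces.\<close>

text \<open>All the substitutions used here take this form, which admits induction along \<^const>\<open>pCons\<close>.\<close>

definition horner ::
    "('k::comm_ring_1 \<Rightarrow> 'w::ab_group_add \<Rightarrow> 'w) \<Rightarrow> 'k \<Rightarrow> ('u::zero \<Rightarrow> 'w) \<Rightarrow> 'u poly \<Rightarrow> 'w" where
  "horner s p \<phi> g = (\<Sum>n\<le>degree g. s (p ^ n) (\<phi> (coeff g n)))"

lemma map_poly_additive_add:
  assumes "additive h"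
  shows "map_poly h (f + g) = map_poly h f + map_poly h g"
  by (rule poly_eqI) (simp add: coeff_map_poly additive.zero[OF assms] additive.add[OF assms])

lemma additive_map_poly: "additive h \<Longrightarrow> additive (map_poly h)"
  by (simp add: additive_def map_poly_additive_add)

lemma additive_comp: "additive f \<Longrightarrow> additive g \<Longrightarrow> additive (\<lambda>x. f (g x))"
  by (simp add: additive_def)

lemma additive_pCons: "additive (\<lambda>c. [:c:])"
  by (simp add: additive_def)

section \<open>The action of K[x] on V[x], and substitution in Horner form\<close>

context module
begin

lemma additive_scale: "additive (scale a)"
  by (simp add: additive_def scale_right_distrib)

text \<open>Terms beyond either degree vanish, which leaves the Cauchy product without degree
  bounds; the module laws then follow coefficient by coefficient.\<close>

lemma coeff_pact: "coeff (pact scale p f) n = (\<Sum>i\<le>n. scale (coeff p i) (coeff f (n - i)))"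
proof -
  have "coeff (pact scale p f) n =
      (\<Sum>i\<le>degree p. \<Sum>j\<le>degree f. if i + j = n then scale (coeff p i) (coeff f j) else 0)"
    by (simp add: pact_def coeff_sum)
  also have "\<dots> = (\<Sum>i\<le>degree p. if i \<le> n then scale (coeff p i) (coeff f (n - i)) else 0)"
  proof (rule sum.cong[OF refl])
    fix i
    have "(\<Sum>j\<le>degree f. if i + j = n then scale (coeff p i) (coeff f j) else 0) =
      (\<Sum>j\<le>degree f. if j = n - i then (if i \<le> n then scale (coeff p i) (coeff f j) else 0) else 0)"
      by (rule sum.cong) auto
    then show "(\<Sum>j\<le>degree f. if i + j = n then scale (coeff p i) (coeff f j) else 0) =
        (if i \<le> n then scale (coeff p i) (coeff f (n - i)) else 0)"
      by (auto simp: sum.delta' coeff_eq_0)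
  qed
  also have "\<dots> = (\<Sum>i\<in>{..n} \<inter> {..degree p}. scale (coeff p i) (coeff f (n - i)))"
    by (rule sum.mono_neutral_cong_right) auto
  also have "\<dots> = (\<Sum>i\<le>n. scale (coeff p i) (coeff f (n - i)))"
    by (rule sum.mono_neutral_left) (auto intro!: le_degree)
  finally show ?thesis .
qed

lemma pact_0_left: "pact scale 0 f = 0"
  by (rule poly_eqI) (simp add: coeff_pact)

lemma pact_pCons_left:
  "pact scale (pCons a p) f = map_poly (scale a) f + pCons 0 (pact scale p f)"
proof (rule poly_eqI)
  fix n
  show "coeff (pact scale (pCons a p) f) n =
      coeff (map_poly (scale a) f + pCons 0 (pact scale p f)) n"
    by (cases n) (simp_all add: coeff_pact coeff_map_poly sum.atMost_Suc_shift del: sum.atMost_Suc)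
qed

lemma pact_add_right: "pact scale p (f + g) = pact scale p f + pact scale p g"
  by (rule poly_eqI) (simp add: coeff_pact scale_right_distrib sum.distrib)

lemma pact_add_left: "pact scale (p + q) f = pact scale p f + pact scale q f"
  by (rule poly_eqI) (simp add: coeff_pact scale_left_distrib sum.distrib)

lemma pact_smult_left: "pact scale (smult a p) f = map_poly (scale a) (pact scale p f)"
  by (rule poly_eqI) (simp add: coeff_pact coeff_map_poly scale_sum_right)

lemma pact_const: "pact scale [:a:] f = map_poly (scale a) f"
  by (simp add: pact_pCons_left pact_0_left)

lemma pact_var: "pact scale [:0, 1:] f = pCons 0 f"
proof -
  have "map_poly (scale 0) f = 0" "map_poly (scale 1) f = f"
    by (auto intro!: poly_eqI simp: coeff_map_poly)
  then show ?thesis by (simp add: pact_pCons_left pact_0_left)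
qed

lemma map_poly_scale_0: "map_poly (scale 0) f = 0"
  by (rule poly_eqI) (simp add: coeff_map_poly)

lemma pact_mult_left: "pact scale (p * q) f = pact scale p (pact scale q f)"
  by (induction p)
    (simp_all add: pact_0_left pact_pCons_left pact_add_left pact_smult_left map_poly_scale_0)

text \<open>This makes the construction iterable: V[\<lambda>] is a module again, hence so is
  V[\<lambda>,\<mu>].\<close>

lemma module_pact: "module (pact scale)"
proof
  show "pact scale 1 f = f" for f
    by (rule poly_eqI) (simp add: one_pCons pact_const coeff_map_poly)
qed (simp_all add: pact_add_right pact_add_left pact_mult_left)

lemma horner_0 [simp]: "\<phi> 0 = 0 \<Longrightarrow> horner scale p \<phi> 0 = 0"
  by (simp add: horner_def)

lemma horner_pCons:
  assumes "\<phi> 0 = 0"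
  shows "horner scale p \<phi> (pCons a g) = \<phi> a + scale p (horner scale p \<phi> g)"
proof (cases "g = 0")
  case True
  with assms show ?thesis by (simp add: horner_def)
next
  case False
  then show ?thesis
    by (simp add: horner_def sum.atMost_Suc_shift scale_sum_right del: sum.atMost_Suc)
qed

lemma horner_add:
  assumes "additive \<phi>"
  shows "horner scale p \<phi> (f + g) = horner scale p \<phi> f + horner scale p \<phi> g"
proof -
  have 0: "\<phi> 0 = 0" by (rule additive.zero[OF assms])
  show ?thesis
    by (induction f g rule: poly_induct2)
      (simp_all add: horner_pCons 0 additive.add[OF assms] scale_right_distrib algebra_simps)
qed

lemma additive_horner: "additive \<phi> \<Longrightarrow> additive (horner scale p \<phi>)"
  by (metis additive_def horner_add)

lemma horner_map_poly:
  assumes "h 0 = 0" "\<phi> 0 = 0"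
  shows "horner scale p \<phi> (map_poly h g) = horner scale p (\<lambda>x. \<phi> (h x)) g"
  by (induction g) (simp_all add: assms horner_pCons map_poly_pCons)

text \<open>Induction along Horner's scheme: each step applies \<open>p\<close> once, and
  \<open>h\<close> exchanges it for \<open>q\<close>. The map \<open>h\<close> need not be linear
  over any common ring.\<close>

lemma horner_commute:
  assumes "module t" "additive h" "\<And>x. h (scale p x) = t q (h x)" "\<phi> 0 = 0"
  shows "h (horner scale p \<phi> g) = horner t q (\<lambda>x. h (\<phi> x)) g"
proof -
  interpret t: module t by fact
  interpret h: additive h by fact
  show ?thesis
    by (induction g) (simp_all add: assms(3,4) horner_pCons t.horner_pCons h.add h.zero)
qed

lemma scale_horner:
  assumes "\<phi> 0 = 0"
  shows "scale k (horner scale p \<phi> g) = horner scale p (\<lambda>x. scale k (\<phi> x)) g"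
  by (rule horner_commute[OF module_axioms]) (simp_all add: assms additive_scale mult.commute)

text \<open>Together with \<open>horner_pact_var\<close>, this describes a substitution on the
  generators of the scalars: constants act through \<phi>, the variable acts as \<open>p\<close>.
  The intertwining hypotheses of \<open>horner_commute\<close> are checked this way.\<close>

lemma horner_pact_const:
  assumes "\<phi> 0 = 0" "module t" "\<And>c. \<phi> (scale k c) = t k' (\<phi> c)"
  shows "horner t p \<phi> (pact scale [:k:] g) = t k' (horner t p \<phi> g)"
proof -
  interpret t: module t by fact
  show ?thesis
    by (simp add: pact_const t.horner_map_poly assms t.scale_horner)
qed

lemma horner_pact_var:
  assumes "\<phi> 0 = 0" "module t"
  shows "horner t p \<phi> (pact scale [:0, 1:] g) = t p (horner t p \<phi> g)"
proof -
  interpret t: module t by fact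
  show ?thesis
    by (simp add: pact_var t.horner_pCons assms)
qed

end

section \<open>Substitutions in one and two variables, and \<open>app2\<close>\<close>

text \<open>The substitution of \<open>p \<in> \<complex>[\<partial>][\<lambda>][\<mu>]\<close> for \<open>\<nu>\<close> in \<open>V[\<nu>]\<close> that occurs inside \<^const>\<open>app2\<close>.\<close>

definition subst2 ::
    "(complex poly \<Rightarrow> 'v::ab_group_add \<Rightarrow> 'v) \<Rightarrow> complex poly poly poly \<Rightarrow> 'v poly
      \<Rightarrow> 'v poly poly" where
  "subst2 s p = horner (pact (pact s)) p (\<lambda>c. [:[:c:]:])"

lemma degree_map_poly_pCons: "degree (map_poly (\<lambda>c. [:c:]) f) = degree f"
  by (rule degree_map_poly) simp

lemma peval_map_poly:
  assumes "\<And>c. \<phi> c = 0 \<longleftrightarrow> c = 0"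
  shows "peval s p (map_poly \<phi> f) = horner s p \<phi> f"
proof -
  have "degree (map_poly \<phi> f) = degree f"
    by (rule degree_map_poly) (simp add: assms)
  moreover have "\<phi> 0 = 0" by (simp add: assms)
  ultimately show ?thesis by (simp add: peval_def horner_def coeff_map_poly)
qed

lemma subst1_eq_horner: "subst1 s p f = horner (pact s) p (\<lambda>c. [:c:]) f"
  by (simp add: subst1_def peval_map_poly)

locale cpoly_module = module scale
  for scale :: "complex poly \<Rightarrow> 'v::ab_group_add \<Rightarrow> 'v"
begin

sublocale P1: module "pact scale" by (rule module_pact)
sublocale P2: module "pact (pact scale)" by (rule P1.module_pact)

abbreviation act2 where "act2 \<equiv> pact (pact scale)"
abbreviation skew where "skew \<equiv> subst1 scale (- D1 - L1)"

lemma additive_subst1: "additive (subst1 scale p)"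
  unfolding subst1_eq_horner by (intro P1.additive_horner additive_pCons)

lemma additive_subst2: "additive (subst2 scale p)"
  unfolding subst2_def by (intro P2.additive_horner) (simp add: additive_def)

text \<open>Written as a scalar action, the monomial commutes with the powers of \<open>p\<close>
  and can be moved outside the substitution in \<open>app2\<close>.\<close>

lemma monom_conv_pact: "monom (monom c i) j = act2 (M2 ^ j * L2 ^ i) [:[:c:]:]"
proof -
  have 1: "pact scale (L1 ^ i) [:c:] = monom c i"
    by (induction i) (simp_all add: pact_mult_left pact_var monom_Suc monom_0 del: mult_pCons_left)
  have 2: "L2 ^ i = [:L1 ^ i:]"
    by (induction i) (simp_all add: one_pCons)
  have 3: "act2 (L2 ^ i) [:f:] = [:pact scale (L1 ^ i) f:]" for f
    by (simp add: 2 P1.pact_const map_poly_pCons)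
  have 4: "act2 (M2 ^ j) [:f:] = monom f j" for f
    by (induction j) (simp_all add: P1.pact_mult_left P1.pact_var monom_Suc monom_0 del: mult_pCons_left)
  show ?thesis by (simp only: P1.pact_mult_left 1 3 4)
qed

lemma app2_eq_sum:
  "app2 scale p f u =
    (\<Sum>j\<le>degree u. \<Sum>i\<le>degree (coeff u j). act2 (M2 ^ j * L2 ^ i) (subst2 scale p (f (coeff (coeff u j) i))))"
  unfolding app2_def subst2_def
  by (simp add: peval_map_poly monom_conv_pact[symmetric] P2.scale_horner[of "\<lambda>c. [:[:c:]:]", simplified])

text \<open>For an argument in a single variable the double sum of \<open>app2\<close> collapses to
  Horner form, so \<open>horner_commute\<close> becomes applicable.\<close>

lemma app2_in_lam:
  "app2 scale p f (in_lam g) = horner act2 L2 (\<lambda>x. subst2 scale p (f x)) g"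
  by (simp add: app2_eq_sum in_lam_def horner_def)

lemma app2_in_mu:
  "app2 scale p f (in_mu g) = horner act2 M2 (\<lambda>x. subst2 scale p (f x)) g"
  by (simp add: app2_eq_sum in_mu_def horner_def degree_map_poly_pCons coeff_map_poly)

lemma act2_pCons: "act2 [:k:] [:f:] = [:pact scale k f:]"
  by (simp add: P1.pact_const map_poly_pCons)

lemma subst2_D: "subst2 scale p (pact scale D1 f) = act2 D2 (subst2 scale p f)"
  unfolding subst2_def
  by (rule horner_pact_const[OF _ P2.module_axioms]) (simp_all add: act2_pCons pact_const map_poly_pCons)

lemma subst2_L: "subst2 scale p (pact scale L1 f) = act2 p (subst2 scale p f)"
  unfolding subst2_def by (rule horner_pact_var[OF _ P2.module_axioms]) simp

text \<open>Substitution of \<open>p\<close> fixes \<partial> and sends \<lambda> to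
  \<open>p\<close>, so it sends -\<partial> - \<lambda> to -\<partial> - \<open>p\<close>. All
  subscripts with -\<partial> in the conditions arise in this way.\<close>

lemma subst2_subst1: "subst2 scale p (skew f) = subst2 scale (- D2 - p) f"
proof -
  interpret I: additive "subst2 scale p" by (rule additive_subst2)
  have "subst2 scale p (skew f) = horner act2 (- D2 - p) (\<lambda>x. subst2 scale p [:x:]) f"
    unfolding subst1_eq_horner
    by (rule P1.horner_commute[OF P2.module_axioms additive_subst2])
      (simp_all add: P1.scale_left_diff_distrib P2.scale_left_diff_distrib subst2_D subst2_L I.diff I.minus
         del: minus_pCons)
  then show ?thesis by (simp add: subst2_def P2.horner_pCons)
qed

lemma subst2_L2: "subst2 scale L2 f = [:f:]"
  by (induction f)
    (simp_all add: subst2_def P2.horner_pCons act2_pCons pact_var)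

text \<open>An involution, since -\<partial> - (-\<partial> - \<lambda>) = \<lambda>.\<close>

lemma subst1_subst1: "skew (skew f) = f"
proof -
  interpret I: additive skew by (rule additive_subst1)
  have D: "skew (pact scale D1 f) = pact scale D1 (skew f)" for f
    unfolding subst1_eq_horner
    by (rule horner_pact_const[OF _ P1.module_axioms]) (simp_all add: pact_const map_poly_pCons)
  have L: "skew (pact scale L1 f) = pact scale (- D1 - L1) (skew f)" for f
    unfolding subst1_eq_horner by (rule horner_pact_var[OF _ P1.module_axioms]) simp
  have "skew (skew f) = horner (pact scale) L1 (\<lambda>x. skew [:x:]) f"
    unfolding subst1_eq_horner[of _ _ f]
    by (rule P1.horner_commute[OF P1.module_axioms additive_subst1])
      (simp_all add: P1.scale_left_diff_distrib D L I.diff I.minus del: minus_pCons)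
  also have "\<dots> = f"
    by (induction f) (simp_all add: P1.horner_pCons subst1_eq_horner pact_var)
  finally show ?thesis .
qed

text \<open>Agreement on the coefficients suffices; these are homogeneous in the applications, so
  sign rules can be used under \<open>app2\<close>.\<close>

lemma app2_cong_in_lam:
  assumes "\<And>n. f (coeff g n) = f' (coeff g n)"
  shows "app2 scale p f (in_lam g) = app2 scale p f' (in_lam g)"
  by (simp add: app2_eq_sum in_lam_def assms)

lemma app2_subst1: "app2 scale p (\<lambda>x. skew (f x)) u = app2 scale (- D2 - p) f u"
  unfolding app2_eq_sum subst2_subst1 by (rule refl)

lemma app2_uminus: "app2 scale p (\<lambda>x. - f x) u = - app2 scale p f u"
  by (simp add: app2_eq_sum additive.minus[OF additive_subst2] sum_negf)

lemma app2_ksgn: "app2 scale p (\<lambda>x. ksgn e (f x)) u = ksgn e (app2 scale p f u)"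
  by (simp add: ksgn_def app2_uminus)

lemma app2_plus_fun: "app2 scale p (\<lambda>x. f x + g x) u = app2 scale p f u + app2 scale p g u"
  by (simp add: app2_eq_sum additive.add[OF additive_subst2] sum.distrib P2.scale_right_distrib)

lemma additive_app2_in_lam:
  "additive f \<Longrightarrow> additive (\<lambda>g. app2 scale p f (in_lam g))"
  unfolding app2_in_lam by (intro P2.additive_horner additive_comp[OF additive_subst2])

lemma additive_app2_in_mu:
  "additive f \<Longrightarrow> additive (\<lambda>g. app2 scale p f (in_mu g))"
  unfolding app2_in_mu by (intro P2.additive_horner additive_comp[OF additive_subst2])

section \<open>Reflection in the variable \<mu>\<close>

text \<open>The substitution \<open>\<mu> \<mapsto> -\<partial> - \<lambda> - \<mu>\<close> on \<open>V[\<lambda>,\<mu>]\<close>, with \<open>\<partial>\<close> acting on the coefficients.\<close>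

definition reflect where "reflect = horner act2 (- D2 - L2 - M2) (\<lambda>f. [:f:])"

lemma additive_reflect: "additive reflect"
  unfolding reflect_def by (intro P2.additive_horner additive_pCons)

lemma reflect_const: "reflect (act2 [:k:] w) = act2 [:k:] (reflect w)"
  unfolding reflect_def
  by (rule P1.horner_pact_const[OF _ P2.module_axioms]) (simp_all add: act2_pCons)

lemma reflect_M: "reflect (act2 M2 w) = act2 (- D2 - L2 - M2) (reflect w)"
  unfolding reflect_def by (rule P1.horner_pact_var[OF _ P2.module_axioms]) simp

lemma reflect_pCons [simp]: "reflect [:f:] = [:f:]"
  by (simp add: reflect_def P2.horner_pCons)

text \<open>The argument involves only \<lambda>, which \<open>reflect\<close> fixes; hence only the
  parameter \<open>p\<close> changes.\<close>

lemma reflect_app2_in_lam: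
  assumes "\<And>w. reflect (act2 p w) = act2 p' (reflect w)" "f 0 = 0"
  shows "reflect (app2 scale p f (in_lam g)) = app2 scale p' f (in_lam g)"
proof -
  have "reflect (subst2 scale p h) = subst2 scale p' h" for h
    unfolding subst2_def
    by (subst P2.horner_commute[OF P2.module_axioms additive_reflect, of _ p']) (simp_all add: assms)
  then show ?thesis
    unfolding app2_in_lam
    by (subst P2.horner_commute[OF P2.module_axioms additive_reflect, of _ L2])
      (simp_all add: reflect_const assms(2) additive.zero[OF additive_subst2])
qed

text \<open>Pulling scalars out of \<open>d\<close> turns \<partial> into \<partial> + \<lambda> and
  leaves \<mu> alone. Thus -\<partial> - \<mu> inside \<open>d\<close> comes out as -\<partial> -
  \<lambda> - \<mu>, which is the reflection.\<close>

lemma reflect_app2_in_mu: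
  assumes "additive d" and D: "\<And>x. d (scale [:0, 1:] x) = pact scale (D1 + L1) (d x)"
  shows "reflect (app2 scale L2 d (in_mu g)) = app2 scale L2 d (in_mu (skew g))"
proof -
  interpret d: additive d by fact
  define \<Phi> where "\<Phi> w = horner act2 M2 (\<lambda>x. [:d x:]) w" for w
  have "additive \<Phi>"
    unfolding \<Phi>_def by (intro P2.additive_horner additive_comp[OF additive_pCons] d.additive_axioms)
  then interpret \<Phi>: additive \<Phi> .
  have \<Phi>: "app2 scale L2 d (in_mu w) = \<Phi> w" for w
    by (simp only: app2_in_mu subst2_L2 \<Phi>_def)
  have D: "\<Phi> (pact scale D1 w) = act2 (D2 + L2) (\<Phi> w)" for w
    unfolding \<Phi>_def
    by (rule horner_pact_const[OF _ P2.module_axioms]) (simp_all add: D d.zero act2_pCons)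
  have L: "\<Phi> (pact scale L1 w) = act2 M2 (\<Phi> w)" for w
    unfolding \<Phi>_def by (rule horner_pact_var[OF _ P2.module_axioms]) (simp add: d.zero)
  have q: "\<Phi> (pact scale (- D1 - L1) w) = act2 (- D2 - L2 - M2) (\<Phi> w)" for w
  proof -
    have "\<Phi> (pact scale (- D1 - L1) w) = - \<Phi> (pact scale D1 w) - \<Phi> (pact scale L1 w)"
      by (simp only: P1.scale_left_diff_distrib P1.scale_minus_left \<Phi>.diff \<Phi>.minus)
    also have "\<dots> = act2 (- (D2 + L2) - M2) (\<Phi> w)"
      by (simp only: D L P2.scale_left_diff_distrib P2.scale_minus_left)
    finally show ?thesis by (simp add: algebra_simps)
  qed
  have "\<Phi> (skew g) = horner act2 (- D2 - L2 - M2) (\<lambda>x. \<Phi> [:x:]) g"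
    unfolding subst1_eq_horner
    by (rule P1.horner_commute[where h = \<Phi> and q = "- D2 - L2 - M2", OF P2.module_axioms \<Phi>.additive_axioms q]) simp
  also have "\<dots> = horner act2 (- D2 - L2 - M2) (\<lambda>x. [:d x:]) g"
    by (simp add: \<Phi>_def P2.horner_pCons d.zero)
  also have "\<dots> = reflect (\<Phi> g)"
    unfolding \<Phi>_def
    by (subst P2.horner_commute[where h = reflect and q = "- D2 - L2 - M2", OF P2.module_axioms additive_reflect reflect_M])
      (simp_all add: d.zero)
  finally show ?thesis by (simp only: \<Phi>)
qed

end

section \<open>Signs, and exchanging the arguments of the derivation identity\<close>

lemma ksgn_add: "ksgn e (x + y) = ksgn e x + ksgn e y"
  and ksgn_minus: "ksgn e (- x) = - ksgn e x"
  and ksgn_diff: "ksgn e (x - y) = ksgn e x - ksgn e y"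
  and ksgn_0: "ksgn e 0 = 0"
  and ksgn_ksgn: "ksgn e (ksgn e' x) = ksgn (e + e') x"
  by (cases e; cases e'; simp add: ksgn_def)+

text \<open>Modulo 2, \<alpha>(\<beta> + \<theta>) + \<alpha>\<beta> = \<alpha>\<theta> and
  \<beta>\<theta> + (\<alpha> + \<theta>)\<beta> = \<alpha>\<beta>, so multiplying by the sign of
  \<alpha>\<beta> leaves \<open>z\<close> unsigned.\<close>

lemma sign_cancel:
  assumes "- ksgn (\<alpha> * \<beta>) x =
    - ksgn (\<alpha> * (\<beta> + \<theta>)) y - ksgn (\<beta> * \<theta>) (ksgn ((\<alpha> + \<theta>) * \<beta>) z)"
  shows "x = z + ksgn (\<alpha> * \<theta>) y"
proof -
  from assms have "ksgn (\<alpha> * \<beta>) x =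
      ksgn (\<alpha> * (\<beta> + \<theta>)) y + ksgn (\<beta> * \<theta>) (ksgn ((\<alpha> + \<theta>) * \<beta>) z)"
    by (metis minus_diff_eq diff_minus_eq_add minus_minus add.commute)
  from arg_cong[OF this, of "ksgn (\<alpha> * \<beta>)"] show ?thesis
    by (cases \<alpha>; cases \<beta>; cases \<theta>) (simp_all add: ksgn_def add.commute)
qed

text \<open>The sign exponent is a free parameter rather than a degree, so that additivity in
  \<open>a\<close> and \<open>b\<close> can be stated without homogeneity.\<close>

definition derivation_at ::
    "(complex poly \<Rightarrow> 'r::ab_group_add \<Rightarrow> 'r) \<Rightarrow> ('r \<Rightarrow> 'r \<Rightarrow> 'r poly)
      \<Rightarrow> ('r \<Rightarrow> 'r poly) \<Rightarrow> bit \<Rightarrow> 'r \<Rightarrow> 'r \<Rightarrow> bool" where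
  "derivation_at s br d \<epsilon> a b \<longleftrightarrow>
    app2 s L2 d (in_mu (br a b)) =
      app2 s (L2 + M2) (\<lambda>x. br x b) (in_lam (d a)) + ksgn \<epsilon> (app2 s M2 (br a) (in_lam (d b)))"

text \<open>Reflection sends \<lambda> + \<mu> to -\<partial> - \<mu> and \<mu> to -\<partial> -
  \<lambda> - \<mu>; skew-symmetry reads these back as \<mu> and \<lambda> + \<mu> with the bracket
  arguments exchanged. The two terms on the right thus trade places.\<close>

lemma (in cpoly_module) derivation_at_flip:
  assumes d: "additive d" "\<And>x. d (scale [:0, 1:] x) = pact scale (D1 + L1) (d x)"
    and br: "\<And>x. additive (br x)" "\<And>y. additive (\<lambda>x. br x y)"
    and skew_symm: "\<And>\<alpha> \<beta> x y. x \<in> gr \<alpha> \<Longrightarrow> y \<in> gr \<beta> \<Longrightarrow> br x y = - ksgn (\<alpha> * \<beta>) (skew (br y x))"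
    and hom: "a \<in> gr \<alpha>" "b \<in> gr \<beta>" "\<And>n. coeff (d a) n \<in> gr (\<alpha> + \<theta>)" "\<And>n. coeff (d b) n \<in> gr (\<beta> + \<theta>)"
    and D: "derivation_at scale br d (\<beta> * \<theta>) b a"
  shows "derivation_at scale br d (\<alpha> * \<theta>) a b"
proof -
  interpret d: additive d by fact
  interpret reflect: additive reflect by (rule additive_reflect)
  have reflect_LM: "reflect (act2 (L2 + M2) w) = act2 (- D2 - M2) (reflect w)" for w
  proof -
    have "reflect (act2 (L2 + M2) w) = act2 L2 (reflect w) + act2 (- D2 - L2 - M2) (reflect w)"
      by (simp only: P2.scale_left_distrib reflect.add reflect_M reflect_const)
    also have "\<dots> = act2 (L2 + (- D2 - L2 - M2)) (reflect w)"
      by (simp only: P2.scale_left_distrib)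
    finally show ?thesis by simp
  qed
  have skew_symm': "skew (br y x) = - ksgn (\<alpha> * \<beta>) (br x y)" if "x \<in> gr \<alpha>" "y \<in> gr \<beta>" for x y \<alpha> \<beta>
    by (simp add: skew_symm[OF that] ksgn_minus ksgn_ksgn) (simp add: ksgn_def)
  have reflect_ksgn: "reflect (ksgn e w) = ksgn e (reflect w)" for e w
    by (simp add: ksgn_def reflect.minus)
  have "app2 scale L2 d (in_mu (skew (br b a))) = reflect (app2 scale L2 d (in_mu (br b a)))"
    by (rule reflect_app2_in_mu[OF d, symmetric])
  also have "\<dots> = reflect (app2 scale (L2 + M2) (\<lambda>x. br x a) (in_lam (d b)))
      + ksgn (\<beta> * \<theta>) (reflect (app2 scale M2 (br b) (in_lam (d a))))"
    using D by (simp only: derivation_at_def reflect.add reflect_ksgn)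
  also have "reflect (app2 scale (L2 + M2) (\<lambda>x. br x a) (in_lam (d b))) =
      app2 scale (- D2 - M2) (\<lambda>x. br x a) (in_lam (d b))"
    by (rule reflect_app2_in_lam[OF reflect_LM]) (rule additive.zero[OF br(2)])
  also have "\<dots> = app2 scale M2 (\<lambda>x. skew (br x a)) (in_lam (d b))"
    by (simp only: app2_subst1)
  also have "\<dots> = app2 scale M2 (\<lambda>x. - ksgn (\<alpha> * (\<beta> + \<theta>)) (br a x)) (in_lam (d b))"
    by (rule app2_cong_in_lam) (rule skew_symm'[OF hom(1,4)])
  also have "reflect (app2 scale M2 (br b) (in_lam (d a))) =
      app2 scale (- D2 - L2 - M2) (br b) (in_lam (d a))"
    by (rule reflect_app2_in_lam[OF reflect_M]) (rule additive.zero[OF br(1)])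
  also have "\<dots> = app2 scale (L2 + M2) (\<lambda>x. skew (br b x)) (in_lam (d a))"
    by (simp only: app2_subst1 diff_diff_eq)
  also have "\<dots> = app2 scale (L2 + M2) (\<lambda>x. - ksgn ((\<alpha> + \<theta>) * \<beta>) (br x b)) (in_lam (d a))"
    by (rule app2_cong_in_lam) (rule skew_symm'[OF hom(3,2)])
  finally have "app2 scale L2 d (in_mu (- ksgn (\<alpha> * \<beta>) (br a b))) =
      - ksgn (\<alpha> * (\<beta> + \<theta>)) (app2 scale M2 (br a) (in_lam (d b)))
      - ksgn (\<beta> * \<theta>) (ksgn ((\<alpha> + \<theta>) * \<beta>) (app2 scale (L2 + M2) (\<lambda>x. br x b) (in_lam (d a))))"
    by (simp only: skew_symm'[OF hom(1,2)] app2_uminus app2_ksgn ksgn_minus) simp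
  moreover have "app2 scale L2 d (in_mu (- ksgn e w)) = - ksgn e (app2 scale L2 d (in_mu w))" for e w
    by (simp add: ksgn_def additive.minus[OF additive_app2_in_mu[OF d(1)]])
  ultimately have "- ksgn (\<alpha> * \<beta>) (app2 scale L2 d (in_mu (br a b))) =
      - ksgn (\<alpha> * (\<beta> + \<theta>)) (app2 scale M2 (br a) (in_lam (d b)))
      - ksgn (\<beta> * \<theta>) (ksgn ((\<alpha> + \<theta>) * \<beta>) (app2 scale (L2 + M2) (\<lambda>x. br x b) (in_lam (d a))))"
    by (simp only:)
  then show ?thesis
    unfolding derivation_at_def by (rule sign_cancel)
qed

section \<open>Transport along module homomorphisms, in particular the projections of R + M\<close>

lemma map_poly_pact:
  assumes "module s" "module t" "additive h" "\<And>p x. h (s p x) = t p (h x)"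
  shows "map_poly h (pact s q f) = pact t q (map_poly h f)"
proof -
  interpret s: module s by fact
  interpret t: module t by fact
  interpret h: additive h by fact
  show ?thesis
    by (rule poly_eqI) (simp add: coeff_map_poly h.zero s.coeff_pact t.coeff_pact h.sum assms(4))
qed

lemma map_poly_app2:
  assumes "cpoly_module s" "cpoly_module t" "additive h" "\<And>p x. h (s p x) = t p (h x)"
  shows "map_poly (map_poly h) (app2 s p f u) = app2 t p (\<lambda>x. map_poly h (f x)) u"
proof -
  interpret s: cpoly_module s by fact
  interpret t: cpoly_module t by fact
  interpret h: additive h by fact
  interpret h2: additive "map_poly (map_poly h)"
    by (intro additive_map_poly assms)
  have act2: "map_poly (map_poly h) (s.act2 q w) = t.act2 q (map_poly (map_poly h) w)" for q w
    by (intro map_poly_pact additive_map_poly assms s.module_pact t.module_pact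
         s.module_axioms t.module_axioms)
  have "map_poly (map_poly h) (subst2 s p g) =
      horner t.act2 p (\<lambda>c. map_poly (map_poly h) [:[:c:]:]) g" for g
    unfolding subst2_def
    by (rule s.P2.horner_commute[where h = "map_poly (map_poly h)" and q = p,
          OF t.P2.module_axioms h2.additive_axioms act2]) simp
  then have "map_poly (map_poly h) (subst2 s p g) = subst2 t p (map_poly h g)" for g
    by (simp add: subst2_def t.P2.horner_map_poly h.zero map_poly_pCons)
  then show ?thesis
    by (simp only: s.app2_eq_sum t.app2_eq_sum h2.sum act2)
qed

lemma (in cpoly_module) app2_in_lam_map_poly:
  assumes "h 0 = 0" "f 0 = 0"
  shows "app2 scale p f (in_lam (map_poly h g)) = app2 scale p (\<lambda>x. f (h x)) (in_lam g)"
  by (simp add: app2_in_lam P2.horner_map_poly assms additive.zero[OF additive_subst2])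

lemma (in cpoly_module) app2_in_mu_map_poly:
  assumes "h 0 = 0" "f 0 = 0"
  shows "app2 scale p f (in_mu (map_poly h g)) = app2 scale p (\<lambda>x. f (h x)) (in_mu g)"
  by (simp add: app2_in_mu P2.horner_map_poly assms additive.zero[OF additive_subst2])

text \<open>\<open>Vector_Spaces.linear\<close> also asserts that both sides are complex vector
  spaces; the module laws restricted to constants supply this.\<close>

lemma clinear_poly_iff:
  assumes "module s" "module t"
  shows "clinear_poly s t f \<longleftrightarrow> additive f \<and> (\<forall>c x. f (s [:c:] x) = pact t [:[:c:]:] (f x))"
proof -
  have vs: "vector_space (\<lambda>c. s [:c:])" if "module s"
    for s :: "complex poly \<Rightarrow> 'w::ab_group_add \<Rightarrow> 'w"
  proof -
    interpret module s by fact
    show ?thesis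
      by standard (simp_all add: scale_right_distrib scale_left_distrib[symmetric]
          scale_one[unfolded one_pCons] mult.commute)
  qed
  have "vector_space (\<lambda>c. pact t [:[:c:]:])"
  proof -
    interpret module t by fact
    interpret P: module "pact t" by (rule module_pact)
    show ?thesis
      by standard (simp_all add: P.scale_right_distrib P.scale_left_distrib[symmetric]
          P.scale_one[unfolded one_pCons] mult.commute)
  qed
  with vs[OF assms(1)] show ?thesis
    unfolding Vector_Spaces.linear_iff additive_def by blast
qed

lemma conformal_linear_components:
  assumes d: "conformal_linear s gr s gr \<theta> d" and "module s" "module t" "module t'"
    and i: "additive i" "\<And>p x. i (t p x) = s p (i x)" "\<And>\<alpha> x. x \<in> grt \<alpha> \<Longrightarrow> i x \<in> gr \<alpha>"
    and h: "additive h" "\<And>p x. h (s p x) = t' p (h x)" "\<And>\<alpha> x. x \<in> gr \<alpha> \<Longrightarrow> h x \<in> grt' \<alpha>"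
  shows "conformal_linear t grt t' grt' \<theta> (\<lambda>x. map_poly h (d (i x)))"
proof -
  note iff = clinear_poly_iff[OF \<open>module s\<close> \<open>module s\<close>]
    clinear_poly_iff[OF \<open>module t\<close> \<open>module t'\<close>]
  note pact = map_poly_pact[where s = s and t = t' and h = h, OF \<open>module s\<close> \<open>module t'\<close> h(1,2)]
  have D: "additive d \<and> (\<forall>c x. d (s [:c:] x) = pact s [:[:c:]:] (d x))"
    "\<forall>x. d (s [:0, 1:] x) = pact s (D1 + L1) (d x)"
    "\<forall>\<alpha>. \<forall>x\<in>gr \<alpha>. \<forall>n. coeff (d x) n \<in> gr (\<alpha> + \<theta>)"
    using d unfolding conformal_linear_def iff by (rule conjunct1, simp_all)
  note d = conjunct1[OF D(1)] conjunct2[OF D(1), rule_format] D(2,3)[rule_format]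
  show ?thesis
    unfolding conformal_linear_def iff
  proof (intro conjI allI ballI)
    show "additive (\<lambda>x. map_poly h (d (i x)))"
      by (intro additive_comp[OF additive_map_poly[OF h(1)]] additive_comp[OF d(1)] i(1))
    show "coeff (map_poly h (d (i x))) n \<in> grt' (\<alpha> + \<theta>)" if "x \<in> grt \<alpha>" for x \<alpha> n
      using h(3)[OF d(4)[OF i(3)[OF that]]] by (simp add: coeff_map_poly additive.zero[OF h(1)])
  qed (simp_all only: i(2) d(2,3) pact)
qed

section \<open>Homogeneous components\<close>

context graded_module
begin

lemma gr_cases:
  obtains y z where "y \<in> gr \<alpha>" "z \<in> gr (\<alpha> + 1)" "x = y + z"
proof -
  obtain y z where "y \<in> gr 0" "z \<in> gr 1" "x = y + z" using gr_sum by blast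
  then show ?thesis using that by (cases \<alpha>) (auto simp: add.commute)
qed

lemma hpart_eq:
  assumes "y \<in> gr \<alpha>" "z \<in> gr (\<alpha> + 1)"
  shows "hpart gr \<alpha> (y + z) = y"
  unfolding hpart_def
proof (rule the_equality)
  show "y \<in> gr \<alpha> \<and> y + z - y \<in> gr (\<alpha> + 1)" using assms by simp
next
  fix y' assume y': "y' \<in> gr \<alpha> \<and> y + z - y' \<in> gr (\<alpha> + 1)"
  have "y - y' \<in> gr \<alpha>" using assms y' gr_subspace by (auto intro: subspace_diff)
  moreover have "y + z - y' - z \<in> gr (\<alpha> + 1)"
    using assms y' gr_subspace by (blast intro: subspace_diff)
  ultimately have "y - y' \<in> gr 0 \<inter> gr 1" by (cases \<alpha>) auto
  then show "y' = y" by (simp add: gr_inter)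
qed

lemma hpart_add: "hpart gr \<alpha> (x + y) = hpart gr \<alpha> x + hpart gr \<alpha> y"
proof -
  obtain a b where x: "a \<in> gr \<alpha>" "b \<in> gr (\<alpha> + 1)" "x = a + b" by (rule gr_cases)
  obtain a' b' where y: "a' \<in> gr \<alpha>" "b' \<in> gr (\<alpha> + 1)" "y = a' + b'" by (rule gr_cases)
  have "hpart gr \<alpha> ((a + a') + (b + b')) = a + a'"
    by (rule hpart_eq) (use x y gr_subspace in \<open>auto intro: subspace_add\<close>)
  then show ?thesis using x y by (simp add: hpart_eq algebra_simps)
qed

lemma zero_mem_gr: "0 \<in> gr \<alpha>"
  using gr_subspace by (rule subspace_0)

lemma hpart_0: "hpart gr \<alpha> 0 = 0"
  using hpart_eq[OF zero_mem_gr zero_mem_gr] by simp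

lemma hpart_homogeneous:
  assumes "x \<in> gr \<beta>"
  shows "hpart gr \<alpha> x = (if \<alpha> = \<beta> then x else 0)"
proof (cases "\<alpha> = \<beta>")
  case True
  then show ?thesis using hpart_eq[OF assms zero_mem_gr] by simp
next
  case False
  then have "\<beta> = \<alpha> + 1" by (cases \<alpha>; cases \<beta>) auto
  then show ?thesis using hpart_eq[OF zero_mem_gr, of x \<alpha>] assms False by simp
qed

end

lemma poly_prod_eq_iff:
  "f = g \<longleftrightarrow> map_poly fst f = map_poly fst g \<and> map_poly snd f = map_poly snd g"
  for f g :: "('r::zero \<times> 'm::zero) poly"
  by (auto simp: poly_eq_iff coeff_map_poly prod_eq_iff)

lemma poly_poly_prod_eq_iff:
  "f = g \<longleftrightarrow> map_poly (map_poly fst) f = map_poly (map_poly fst) g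
    \<and> map_poly (map_poly snd) f = map_poly (map_poly snd) g"
  for f g :: "('r::zero \<times> 'm::zero) poly poly"
  by (auto simp: poly_eq_iff coeff_map_poly prod_eq_iff)

lemma additive_fst: "additive fst" and additive_snd: "additive snd"
  and additive_inl: "additive (\<lambda>r::'r::ab_group_add. (r, 0::'m::ab_group_add))"
  by (auto simp: additive_def)

lemma map_poly_fst_inl_inr:
    "map_poly fst (map_poly (\<lambda>r. (r, 0)) f + map_poly (\<lambda>m. (0, m)) g) = f"
  and map_poly_snd_inl_inr:
    "map_poly snd (map_poly (\<lambda>r. (r, 0)) f + map_poly (\<lambda>m. (0, m)) g) = g"
  for f :: "'r::ab_group_add poly" and g :: "'m::ab_group_add poly"
  by (rule poly_eqI, simp add: coeff_map_poly zero_prod_def)+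

lemma map_poly_subst1:
  assumes "cpoly_module s" "cpoly_module t" and h: "additive h" "\<And>p x. h (s p x) = t p (h x)"
  shows "map_poly h (subst1 s p f) = subst1 t p (map_poly h f)"
proof -
  interpret s: cpoly_module s by fact
  interpret t: cpoly_module t by fact
  have "map_poly h (horner (pact s) p (\<lambda>c. [:c:]) f) =
      horner (pact t) p (\<lambda>c. map_poly h [:c:]) f"
    by (rule s.P1.horner_commute[where h = "map_poly h" and t = "pact t" and q = p])
      (simp_all add: t.P1.module_axioms additive_map_poly h(1)
        map_poly_pact[where s = s and t = t and h = h, OF s.module_axioms t.module_axioms h])
  then show ?thesis
    by (simp add: subst1_eq_horner t.P1.horner_map_poly additive.zero[OF h(1)] map_poly_pCons)
qed

lemma additive_ksgn: "additive h \<Longrightarrow> h (ksgn e f) = ksgn e (h f)"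
  by (simp add: ksgn_def additive.minus)

lemma map_poly_minus_ksgn:
  "additive h \<Longrightarrow> map_poly h (- ksgn e f) = - ksgn e (map_poly h f)"
  by (simp add: additive.minus[OF additive_map_poly] additive_ksgn[OF additive_map_poly])

section \<open>The bracket of the semidirect product\<close>

context conformal_module
begin

abbreviation sS where "sS \<equiv> sd_scale sR sM"
abbreviation sB where "sB \<equiv> sd_bracket grR br sM grM rho"
abbreviation grS where "grS \<equiv> sd_grade grR grM"

sublocale RP: cpoly_module sR
  by (simp add: cpoly_module_def R.module_axioms)

sublocale MP: cpoly_module sM
  by (simp add: cpoly_module_def M.module_axioms)

sublocale SP: cpoly_module sS
  unfolding cpoly_module_def
  by standard (simp_all add: sd_scale_def R.scale_right_distrib R.scale_left_distrib
      M.scale_right_distrib M.scale_left_distrib)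

lemma fst_sS: "fst (sS p x) = sR p (fst x)" and snd_sS: "snd (sS p x) = sM p (snd x)"
  by (simp_all add: sd_scale_def)

lemma additive_br_right: "additive (br a)" and additive_br_left: "additive (\<lambda>a. br a b)"
  using R.br_linear_right R.br_linear_left
  by (simp_all add: clinear_poly_iff R.module_axioms)

lemma additive_rho_left: "additive (\<lambda>r. rho r m)"
  using rho_linear by (simp add: clinear_poly_iff R.module_axioms M.module_axioms)

text \<open>The axioms give this only for homogeneous \<open>r\<close>; in general
  \<open>rho r\<close> is the sum of two such maps.\<close>

lemma additive_rho_right: "additive (rho r)"
proof -
  obtain y z where yz: "y \<in> grR 0" "z \<in> grR 1" "r = y + z" using R.gr_sum by blast
  have hom: "additive (rho x)" if "x \<in> grR \<alpha>" for x \<alpha>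
    using rho_graded[OF that] by (simp add: conformal_linear_def clinear_poly_iff M.module_axioms)
  have "rho r = (\<lambda>m. rho y m + rho z m)"
    using yz(3) additive.add[OF additive_rho_left] by auto
  then show ?thesis
    using hom[OF yz(1)] hom[OF yz(2)] by (simp add: additive_def)
qed

text \<open>The term of the bracket of \<open>R \<ltimes> M\<close> in which the second argument acts on the first.\<close>

definition twist :: "'r \<times> 'm \<Rightarrow> 'r \<times> 'm \<Rightarrow> 'm poly" where
  "twist x y = (\<Sum>\<alpha>\<in>{0, 1}. \<Sum>\<beta>\<in>{0, 1}. ksgn (\<alpha> * \<beta>)
     (MP.skew (rho (hpart grR \<alpha> (fst y)) (hpart grM \<beta> (snd x)))))"

lemma fst_sB: "map_poly fst (sB x y) = br (fst x) (fst y)"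
  unfolding sd_bracket_def by (rule map_poly_fst_inl_inr)

lemma snd_sB: "map_poly snd (sB x y) = rho (fst x) (snd y) - twist x y"
  unfolding sd_bracket_def twist_def by (rule map_poly_snd_inl_inr)

lemmas zeros = additive.zero[OF additive_br_right] additive.zero[OF additive_br_left]
  additive.zero[OF additive_rho_right] additive.zero[OF additive_rho_left]

lemmas adds = additive.add[OF additive_br_right] additive.add[OF additive_br_left]
  additive.add[OF additive_rho_right] additive.add[OF additive_rho_left]

lemma twist_0: "fst y = 0 \<or> snd x = 0 \<Longrightarrow> twist x y = 0"
  by (auto simp: twist_def R.hpart_0 M.hpart_0 zeros additive.zero[OF MP.additive_subst1] ksgn_0)

lemma twist_homogeneous:
  assumes "fst y \<in> grR \<alpha>" "snd x \<in> grM \<beta>"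
  shows "twist x y = ksgn (\<alpha> * \<beta>) (MP.skew (rho (fst y) (snd x)))"
  by (cases \<alpha>; cases \<beta>)
    (simp_all add: twist_def R.hpart_homogeneous[OF assms(1)] M.hpart_homogeneous[OF assms(2)]
      zeros additive.zero[OF MP.additive_subst1] ksgn_0)

lemma additive_twist: "additive (twist x)" "additive (\<lambda>x. twist x y)"
  unfolding additive_def twist_def
  by (simp_all add: R.hpart_add M.hpart_add adds additive.add[OF MP.additive_subst1] ksgn_add)

lemma additive_sB: "additive (sB x)" "additive (\<lambda>x. sB x y)"
  unfolding additive_def
  by (simp_all add: poly_prod_eq_iff map_poly_additive_add[OF additive_fst]
      map_poly_additive_add[OF additive_snd] fst_sB snd_sB adds
      additive_twist[unfolded additive_def])

lemma sB_RR: "sB (r, 0) (r', 0) = map_poly (\<lambda>r. (r, 0)) (br r r')"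
  and sB_RM: "sB (r, 0) (0, m) = map_poly (\<lambda>m. (0, m)) (rho r m)"
  and sB_MM: "sB (0, m) (0, m') = 0"
  by (simp_all add: poly_prod_eq_iff fst_sB snd_sB twist_0 zeros)
     (simp_all add: poly_eq_iff coeff_map_poly zero_prod_def)

text \<open>The R-component is \<open>C2\<close>. In the M-component the roles of \<open>rho\<close>
  and \<open>twist\<close> are exchanged, and \<open>skew\<close> being an involution restores the
  untwisted action. This supplies the skew-symmetry required by
  \<open>derivation_at_flip\<close>.\<close>

lemma sB_skew:
  assumes "x \<in> grS \<alpha>" "y \<in> grS \<beta>"
  shows "sB x y = - ksgn (\<alpha> * \<beta>) (SP.skew (sB y x))"
proof -
  have fst: "map_poly fst (SP.skew f) = RP.skew (map_poly fst f)" for f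
    by (rule map_poly_subst1[where h = fst, OF SP.cpoly_module_axioms RP.cpoly_module_axioms additive_fst fst_sS])
  have snd: "map_poly snd (SP.skew f) = MP.skew (map_poly snd f)" for f
    by (rule map_poly_subst1[where h = snd, OF SP.cpoly_module_axioms MP.cpoly_module_axioms additive_snd snd_sS])
  interpret S: additive MP.skew by (rule MP.additive_subst1)
  have Sk: "MP.skew (ksgn e f) = ksgn e (MP.skew f)" for e f
    by (rule additive_ksgn[OF S.additive_axioms])
  from assms have *: "fst x \<in> grR \<alpha>" "snd x \<in> grM \<alpha>" "fst y \<in> grR \<beta>" "snd y \<in> grM \<beta>"
    by (auto simp: sd_grade_def)
  have "map_poly fst (sB x y) = map_poly fst (- ksgn (\<alpha> * \<beta>) (SP.skew (sB y x)))"
    unfolding map_poly_minus_ksgn[OF additive_fst] fst fst_sB by (rule R.C2[OF *(1,3)])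
  moreover have "map_poly snd (sB x y) = map_poly snd (- ksgn (\<alpha> * \<beta>) (SP.skew (sB y x)))"
    unfolding map_poly_minus_ksgn[OF additive_snd] snd snd_sB
      twist_homogeneous[OF *(3,2)] twist_homogeneous[OF *(1,4)] S.diff Sk MP.subst1_subst1
      ksgn_diff ksgn_ksgn
    by (simp add: mult.commute) (simp add: ksgn_def)
  ultimately show ?thesis by (simp only: poly_prod_eq_iff)
qed

end

lemma (in cpoly_module) derivation_at_add_right:
  assumes d: "additive d" and br: "\<And>x. additive (br x)"
    and D: "derivation_at scale br d \<epsilon> a b" "derivation_at scale br d \<epsilon> a b'"
  shows "derivation_at scale br d \<epsilon> a (b + b')"
  using D unfolding derivation_at_def
  by (simp only: additive.add[OF br] additive.add[OF d] app2_plus_fun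
      additive.add[OF additive_app2_in_mu[OF d]] additive.add[OF additive_app2_in_lam[OF br]]
      ksgn_add) (simp only: ac_simps)

text \<open>Both summands share \<epsilon>; in the application they have a common degree, so their
  signs agree.\<close>

lemma (in cpoly_module) derivation_at_add_left:
  assumes d: "additive d" and br: "\<And>y. additive (\<lambda>x. br x y)"
    and D: "derivation_at scale br d \<epsilon> a b" "derivation_at scale br d \<epsilon> a' b"
  shows "derivation_at scale br d \<epsilon> (a + a') b"
proof -
  have "br (a + a') = (\<lambda>x. br a x + br a' x)"
    by (rule ext) (rule additive.add[OF br])
  then show ?thesis
    using D unfolding derivation_at_def
    by (simp only: additive.add[OF d] app2_plus_fun
        additive.add[OF additive_app2_in_mu[OF d]] additive.add[OF additive_app2_in_lam[OF br]]
        ksgn_add) (simp only: ac_simps)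
qed

section \<open>The derivation identity on pairs from R and M\<close>

context conformal_module
begin

lemma app2_br_fst_left:
  "app2 sR p (\<lambda>z. br (fst z) b) (in_lam f) = app2 sR p (\<lambda>x. br x b) (in_lam (map_poly fst f))"
  by (rule RP.app2_in_lam_map_poly[symmetric]) (simp_all add: zeros)

lemma app2_br_fst_right:
  "app2 sR p (\<lambda>z. br a (fst z)) (in_lam f) = app2 sR p (br a) (in_lam (map_poly fst f))"
  by (rule RP.app2_in_lam_map_poly[symmetric]) (simp_all add: zeros)

lemma app2_rho_fst:
  "app2 sM p (\<lambda>z. rho (fst z) m) (in_lam f) = app2 sM p (\<lambda>x. rho x m) (in_lam (map_poly fst f))"
  by (rule MP.app2_in_lam_map_poly[symmetric]) (simp_all add: zeros)

lemma app2_rho_snd: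
  "app2 sM p (\<lambda>z. rho r (snd z)) (in_lam f) = app2 sM p (rho r) (in_lam (map_poly snd f))"
  by (rule MP.app2_in_lam_map_poly[symmetric]) (simp_all add: zeros)

text \<open>The \<open>skew\<close> inside \<open>twist\<close> replaces \<open>p\<close> by
  -\<partial> - \<open>p\<close>; at \<open>p\<close> = \<lambda> + \<mu> this produces the
  subscript in the definition of a derivation into M.\<close>

lemma app2_twist_left:
  assumes "r \<in> grR \<beta>" "\<And>n. coeff f n \<in> grS \<gamma>"
  shows "app2 sM p (\<lambda>z. - twist z (r, 0)) (in_lam f) =
    - ksgn (\<gamma> * \<beta>) (app2 sM (- D2 - p) (rho r) (in_lam (map_poly snd f)))"
proof -
  have "app2 sM p (\<lambda>z. - twist z (r, 0)) (in_lam f) =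
      app2 sM p (\<lambda>z. - ksgn (\<beta> * \<gamma>) (MP.skew (rho r (snd z)))) (in_lam f)"
    by (rule MP.app2_cong_in_lam)
      (use assms twist_homogeneous[of "(r, 0)" \<beta> _ \<gamma>] in \<open>auto simp: sd_grade_def mem_Times_iff\<close>)
  then show ?thesis
    by (simp only: MP.app2_uminus MP.app2_ksgn MP.app2_subst1 app2_rho_snd mult.commute)
qed

text \<open>At \<open>p\<close> = \<mu> this produces the subscript -\<partial> - \<mu> of condition
  (2).\<close>

lemma app2_twist_right:
  assumes "m \<in> grM \<beta>" "\<And>n. coeff f n \<in> grS \<gamma>"
  shows "app2 sM p (\<lambda>z. - twist (0, m) z) (in_lam f) =
    - ksgn (\<gamma> * \<beta>) (app2 sM (- D2 - p) (\<lambda>x. rho x m) (in_lam (map_poly fst f)))"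
proof -
  have "app2 sM p (\<lambda>z. - twist (0, m) z) (in_lam f) =
      app2 sM p (\<lambda>z. - ksgn (\<gamma> * \<beta>) (MP.skew (rho (fst z) m))) (in_lam f)"
    by (rule MP.app2_cong_in_lam)
      (use assms twist_homogeneous[of _ \<gamma> "(0, m)" \<beta>] in \<open>auto simp: sd_grade_def mem_Times_iff\<close>)
  then show ?thesis
    by (simp only: MP.app2_uminus MP.app2_ksgn MP.app2_subst1 app2_rho_fst)
qed

lemma derivation_at_components:
  "derivation_at sS sB d \<epsilon> x y \<longleftrightarrow>
    app2 sR L2 (\<lambda>z. map_poly fst (d z)) (in_mu (sB x y)) =
      app2 sR (L2 + M2) (\<lambda>z. br z (fst y)) (in_lam (map_poly fst (d x)))
      + ksgn \<epsilon> (app2 sR M2 (br (fst x)) (in_lam (map_poly fst (d y)))) \<and>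
    app2 sM L2 (\<lambda>z. map_poly snd (d z)) (in_mu (sB x y)) =
      app2 sM (L2 + M2) (\<lambda>z. rho (fst z) (snd y) - twist z y) (in_lam (d x))
      + ksgn \<epsilon> (app2 sM M2 (\<lambda>z. rho (fst x) (snd z) - twist x z) (in_lam (d y)))"
proof -
  have fst: "map_poly (map_poly fst) (app2 sS p f u) = app2 sR p (\<lambda>x. map_poly fst (f x)) u"
    for p and f :: "'x::ab_group_add \<Rightarrow> _" and u
    by (rule map_poly_app2[where s = sS and t = sR and h = fst,
          OF SP.cpoly_module_axioms RP.cpoly_module_axioms additive_fst fst_sS])
  have snd: "map_poly (map_poly snd) (app2 sS p f u) = app2 sM p (\<lambda>x. map_poly snd (f x)) u"
    for p and f :: "'x::ab_group_add \<Rightarrow> _" and u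
    by (rule map_poly_app2[where s = sS and t = sM and h = snd,
          OF SP.cpoly_module_axioms MP.cpoly_module_axioms additive_snd snd_sS])
  have ks: "map_poly h (f + ksgn e g) = map_poly h f + ksgn e (map_poly h g)" if "additive h" for h e f g
    using additive.add[OF additive_map_poly, OF that] additive.minus[OF additive_map_poly, OF that]
    by (simp add: ksgn_def)
  show ?thesis
    by (simp only: derivation_at_def poly_poly_prod_eq_iff ks[OF additive_map_poly[OF additive_fst]]
       ks[OF additive_map_poly[OF additive_snd]] fst snd fst_sB snd_sB app2_br_fst_left app2_br_fst_right)
qed

lemma component_simps:
  "d11 d = (\<lambda>r. map_poly fst (d (r, 0)))" "d12 d = (\<lambda>m. map_poly fst (d (0, m)))"
  "d21 d = (\<lambda>r. map_poly snd (d (r, 0)))" "d22 d = (\<lambda>m. map_poly snd (d (0, m)))"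
  by (simp_all add: fun_eq_iff d11_def d12_def d21_def d22_def)

lemma derivation_at_RR:
  assumes "d 0 = 0" "r' \<in> grR \<beta>" "\<And>n. coeff (d (r, 0)) n \<in> grS \<gamma>"
  shows "derivation_at sS sB d \<epsilon> (r, 0) (r', 0) \<longleftrightarrow>
    derivation_at sR br (d11 d) \<epsilon> r r' \<and>
    app2 sM L2 (d21 d) (in_mu (br r r')) =
      ksgn \<epsilon> (app2 sM M2 (rho r) (in_lam (d21 d r')))
      - ksgn (\<gamma> * \<beta>) (app2 sM (- D2 - L2 - M2) (rho r') (in_lam (d21 d r)))"
proof -
  have "app2 sM L2 (\<lambda>z. map_poly snd (d z)) (in_mu (sB (r, 0) (r', 0))) =
      app2 sM L2 (\<lambda>r. map_poly snd (d (r, 0))) (in_mu (br r r'))"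
    "app2 sR L2 (\<lambda>z. map_poly fst (d z)) (in_mu (sB (r, 0) (r', 0))) =
      app2 sR L2 (\<lambda>r. map_poly fst (d (r, 0))) (in_mu (br r r'))"
    unfolding sB_RR
    by (rule MP.app2_in_mu_map_poly RP.app2_in_mu_map_poly;
        simp add: assms(1) flip: zero_prod_def)+
  then show ?thesis
    unfolding derivation_at_components unfolding derivation_at_def component_simps
    by (simp only: fst_conv snd_conv zeros twist_0 app2_rho_snd diff_0 diff_0_right
        app2_twist_left[OF assms(2,3)] diff_diff_eq simp_thms) (simp only: ac_simps diff_conv_add_uminus)
qed

text \<open>Both twists vanish, because each has a zero R-part in its second argument or a zero
  M-part in its first. No sign depends on \<open>m\<close>, which therefore ranges over all of
  M.\<close>

lemma derivation_at_RM:
  assumes "d 0 = 0"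
  shows "derivation_at sS sB d \<epsilon> (r, 0) (0, m) \<longleftrightarrow>
    app2 sR L2 (d12 d) (in_mu (rho r m)) = ksgn \<epsilon> (app2 sR M2 (br r) (in_lam (d12 d m))) \<and>
    app2 sM L2 (d22 d) (in_mu (rho r m)) =
      app2 sM (L2 + M2) (\<lambda>x. rho x m) (in_lam (d11 d r))
      + ksgn \<epsilon> (app2 sM M2 (rho r) (in_lam (d22 d m)))"
proof -
  have "app2 sM L2 (\<lambda>z. map_poly snd (d z)) (in_mu (sB (r, 0) (0, m))) =
      app2 sM L2 (\<lambda>m. map_poly snd (d (0, m))) (in_mu (rho r m))"
    "app2 sR L2 (\<lambda>z. map_poly fst (d z)) (in_mu (sB (r, 0) (0, m))) =
      app2 sR L2 (\<lambda>m. map_poly fst (d (0, m))) (in_mu (rho r m))"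
    unfolding sB_RM
    by (rule MP.app2_in_mu_map_poly RP.app2_in_mu_map_poly;
        simp add: assms(1) flip: zero_prod_def)+
  moreover have "app2 sR p (\<lambda>z. 0) u = 0" for p and u :: "'r poly poly"
    by (simp add: RP.app2_eq_sum additive.zero[OF RP.additive_subst2])
  ultimately show ?thesis
    unfolding derivation_at_components component_simps
    by (simp only: fst_conv snd_conv zeros twist_0 app2_rho_fst app2_rho_snd diff_0_right
        simp_thms add_0_left)
qed

text \<open>M brackets trivially with itself, so the left side is zero and the two terms on the
  right must cancel.\<close>

lemma derivation_at_MM:
  assumes "d 0 = 0" "m \<in> grM \<alpha>" "\<And>n. coeff (d (0, m')) n \<in> grS (\<beta> + \<theta>)"
  shows "derivation_at sS sB d (\<alpha> * \<theta>) (0, m) (0, m') \<longleftrightarrow>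
    app2 sM (L2 + M2) (\<lambda>r. rho r m') (in_lam (d12 d m)) =
      ksgn (\<alpha> * \<beta>) (app2 sM (- D2 - M2) (\<lambda>r. rho r m) (in_lam (d12 d m')))"
proof -
  have R0: "app2 sR p (\<lambda>z. 0) u = 0" for p and u :: "'r poly poly"
    by (simp add: RP.app2_eq_sum additive.zero[OF RP.additive_subst2])
  have in_mu_0: "app2 sR p f (in_mu 0) = 0" "app2 sM p g (in_mu 0) = 0"
    if "f 0 = 0" "g 0 = 0" for p and f :: "'r \<times> 'm \<Rightarrow> _" and g :: "'r \<times> 'm \<Rightarrow> _"
    using that by (simp_all add: RP.app2_in_mu MP.app2_in_mu additive.zero[OF RP.additive_subst2]
      additive.zero[OF MP.additive_subst2])
  have br0: "br 0 = (\<lambda>z. 0)" by (simp add: fun_eq_iff zeros)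
  have "derivation_at sS sB d (\<alpha> * \<theta>) (0, m) (0, m') \<longleftrightarrow>
     0 = app2 sM (L2 + M2) (\<lambda>r. rho r m') (in_lam (d12 d m)) +
      ksgn (\<alpha> * \<theta>) (- ksgn ((\<beta> + \<theta>) * \<alpha>) (app2 sM (- D2 - M2) (\<lambda>r. rho r m) (in_lam (d12 d m'))))"
    unfolding derivation_at_components component_simps
    by (simp only: sB_MM fst_conv snd_conv zeros twist_0 app2_rho_fst diff_0_right diff_0
        app2_twist_right[OF assms(2,3)] simp_thms in_mu_0 assms(1) map_poly_0 br0 R0 ksgn_0 add_0_left)
  also have "\<dots> \<longleftrightarrow> app2 sM (L2 + M2) (\<lambda>r. rho r m') (in_lam (d12 d m)) =
      ksgn (\<alpha> * \<beta>) (app2 sM (- D2 - M2) (\<lambda>r. rho r m) (in_lam (d12 d m')))" (is "0 = ?X + _ \<longleftrightarrow> ?X = ksgn _ ?Y")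
  proof -
    \<comment> \<open>The two contributions \<alpha>\<theta> cancel modulo 2.\<close>
    have "ksgn (\<alpha> * \<theta>) (- ksgn ((\<beta> + \<theta>) * \<alpha>) ?Y) = - ksgn (\<alpha> * \<beta>) ?Y"
      unfolding ksgn_minus ksgn_ksgn by (cases \<alpha>; cases \<beta>; cases \<theta>) simp_all
    then show ?thesis by (simp only: eq_commute[of 0] add_eq_0_iff minus_minus) (metis minus_minus)
  qed
  finally show ?thesis .
qed

section \<open>Reduction to homogeneous pairs, and the equivalence\<close>

lemma derivation_iff:
  assumes d: "conformal_linear sS grS sS grS \<theta> d"
  shows "conformal_derivation sS grS sB \<theta> d \<longleftrightarrow>
    (\<forall>\<alpha> \<beta>. \<forall>r\<in>grR \<alpha>. \<forall>r'\<in>grR \<beta>. derivation_at sS sB d (\<alpha> * \<theta>) (r, 0) (r', 0)) \<and>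
    (\<forall>\<alpha>. \<forall>r\<in>grR \<alpha>. \<forall>m. derivation_at sS sB d (\<alpha> * \<theta>) (r, 0) (0, m)) \<and>
    (\<forall>\<alpha> \<beta>. \<forall>m\<in>grM \<alpha>. \<forall>m'\<in>grM \<beta>. derivation_at sS sB d (\<alpha> * \<theta>) (0, m) (0, m'))"
    (is "?L \<longleftrightarrow> ?RR \<and> ?RM \<and> ?MM")
proof -
  have L: "?L \<longleftrightarrow> (\<forall>\<alpha>. \<forall>a\<in>grS \<alpha>. \<forall>b. derivation_at sS sB d (\<alpha> * \<theta>) a b)"
    using d by (simp only: conformal_derivation_def derivation_at_def simp_thms)
  have gr0: "(r, 0) \<in> grS \<alpha>" if "r \<in> grR \<alpha>" for r \<alpha>
    using that by (simp add: sd_grade_def M.zero_mem_gr)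
  have gr1: "(0, m) \<in> grS \<alpha>" if "m \<in> grM \<alpha>" for m \<alpha>
    using that by (simp add: sd_grade_def R.zero_mem_gr)
  have d': "additive d" "\<And>x. d (sS [:0, 1:] x) = pact sS (D1 + L1) (d x)"
      "\<And>x \<alpha> n. x \<in> grS \<alpha> \<Longrightarrow> coeff (d x) n \<in> grS (\<alpha> + \<theta>)"
    using d by (simp_all only: conformal_linear_def clinear_poly_iff[OF SP.module_axioms SP.module_axioms])
  note add_right = SP.derivation_at_add_right[OF d'(1) additive_sB(1)]
  note add_left = SP.derivation_at_add_left[OF d'(1) additive_sB(2)]
  show ?thesis
  proof
    assume ?L
    then show "?RR \<and> ?RM \<and> ?MM" unfolding L using gr0 gr1 by blast
  next
    assume H: "?RR \<and> ?RM \<and> ?MM"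
    show ?L
      unfolding L
    proof (intro allI ballI)
      fix \<alpha> and a b :: "'r \<times> 'm"
      assume "a \<in> grS \<alpha>"
      \<comment> \<open>Both parts of \<open>a\<close> inherit the degree \<alpha>, so a single sign
        serves for both; \<open>b\<close> is arbitrary and is split into homogeneous pieces.\<close>
      then obtain r m where a: "a = (r, 0) + (0, m)" "r \<in> grR \<alpha>" "m \<in> grM \<alpha>"
        by (cases a) (auto simp: sd_grade_def)
      obtain y z where yz: "y \<in> grR 0" "z \<in> grR 1" "fst b = y + z" using R.gr_sum by blast
      obtain v w where vw: "v \<in> grM 0" "w \<in> grM 1" "snd b = v + w" using M.gr_sum by blast
      have b: "b = ((y, 0) + (z, 0)) + ((0, v) + (0, w))"
        using yz vw by (cases b) simp
      \<comment> \<open>The flip of the R-M identity for \<open>y'\<close> and \<open>m\<close>,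
        whose sign exponent is \<beta>\<theta>.\<close>
      have MR: "derivation_at sS sB d (\<alpha> * \<theta>) (0, m) (y', 0)" if y': "y' \<in> grR \<beta>" for y' \<beta>
        by (rule SP.derivation_at_flip[where gr = grS, OF d'(1,2) additive_sB sB_skew gr1[OF a(3)] gr0[OF y']
              d'(3)[OF gr1[OF a(3)]] d'(3)[OF gr0[OF y']]])
          (use H y' in blast)+
      have "derivation_at sS sB d (\<alpha> * \<theta>) (r, 0) b"
        unfolding b using H a(2) yz(1,2) by (intro add_right) blast+
      moreover have "derivation_at sS sB d (\<alpha> * \<theta>) (0, m) b"
        unfolding b using H a(3) vw(1,2) MR[OF yz(1)] MR[OF yz(2)] by (intro add_right) blast+
      ultimately show "derivation_at sS sB d (\<alpha> * \<theta>) a b"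
        unfolding a(1) by (rule add_left)
    qed
  qed
qed

text \<open>The R-R pairs yield the identity only for homogeneous \<open>r'\<close>, since the sign
  in their M-component involves its degree; additivity recovers arbitrary \<open>r'\<close>.\<close>

lemma derivation_R_iff:
  assumes "conformal_linear sR grR sR grR \<theta> f"
  shows "conformal_derivation sR grR br \<theta> f \<longleftrightarrow>
    (\<forall>\<alpha> \<beta>. \<forall>r\<in>grR \<alpha>. \<forall>r'\<in>grR \<beta>. derivation_at sR br f (\<alpha> * \<theta>) r r')" (is "?L \<longleftrightarrow> ?H")
proof -
  have f: "additive f"
    using assms by (simp only: conformal_linear_def clinear_poly_iff[OF R.module_axioms R.module_axioms])
  have "derivation_at sR br f (\<alpha> * \<theta>) r r'" if "?H" "r \<in> grR \<alpha>" for \<alpha> r r'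
  proof -
    obtain y z where yz: "y \<in> grR 0" "z \<in> grR 1" "r' = y + z" using R.gr_sum by blast
    then show ?thesis
      using that unfolding yz(3)
      by (intro RP.derivation_at_add_right[OF f additive_br_right]) blast+
  qed
  then have "?H \<longleftrightarrow> (\<forall>\<alpha>. \<forall>r\<in>grR \<alpha>. \<forall>r'. derivation_at sR br f (\<alpha> * \<theta>) r r')"
    using R.gr_sum by blast
  then show ?thesis
    using assms unfolding conformal_derivation_def derivation_at_def by blast
qed

end

theorem theorem2p24:
  fixes sR :: "complex poly \<Rightarrow> 'r::ab_group_add \<Rightarrow> 'r"
    and grR :: "bit \<Rightarrow> 'r set"
    and br :: "'r \<Rightarrow> 'r \<Rightarrow> 'r poly"
    and sM :: "complex poly \<Rightarrow> 'm::ab_group_add \<Rightarrow> 'm"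
    and grM :: "bit \<Rightarrow> 'm set"
    and rho :: "'r \<Rightarrow> 'm \<Rightarrow> 'm poly"
    and \<theta> :: bit
    and d :: "'r \<times> 'm \<Rightarrow> ('r \<times> 'm) poly"
  assumes "lie_conformal_superalgebra sR grR br"
    and "conformal_module sR grR br sM grM rho"
    and "conformal_linear (sd_scale sR sM) (sd_grade grR grM)
           (sd_scale sR sM) (sd_grade grR grM) \<theta> d"
  shows "conformal_derivation (sd_scale sR sM) (sd_grade grR grM)
           (sd_bracket grR br sM grM rho) \<theta> d
    \<longleftrightarrow>
      conformal_derivation sR grR br \<theta> (d11 d)
    \<and> ((\<forall>\<alpha>. \<forall>r\<in>grR \<alpha>. \<forall>m.
          app2 sR L2 (d12 d) (in_mu (rho r m)) =
            ksgn (\<theta> * \<alpha>) (app2 sR M2 (br r) (in_lam (d12 d m))))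
      \<and> (\<forall>\<alpha> \<beta>. \<forall>m\<in>grM \<alpha>. \<forall>m'\<in>grM \<beta>.
          app2 sM (L2 + M2) (\<lambda>r. rho r m') (in_lam (d12 d m)) =
            ksgn (\<alpha> * \<beta>) (app2 sM (- D2 - M2) (\<lambda>r. rho r m) (in_lam (d12 d m')))))
    \<and> conformal_derivation_into sR grR br sM grM rho \<theta> (d21 d)
    \<and> (\<forall>\<alpha>. \<forall>r\<in>grR \<alpha>. \<forall>m.
          app2 sM L2 (d22 d) (in_mu (rho r m)) =
            app2 sM (L2 + M2) (\<lambda>x. rho x m) (in_lam (d11 d r))
            + ksgn (\<theta> * \<alpha>) (app2 sM M2 (rho r) (in_lam (d22 d m))))"
proof -
  interpret conformal_module sR grR br sM grM rho by fact
  note d = assms(3)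
  have gr: "(r, 0) \<in> grS \<alpha>" "(0, m) \<in> grS \<alpha>" if "r \<in> grR \<alpha>" "m \<in> grM \<alpha>" for r m \<alpha>
    using that by (simp_all add: sd_grade_def R.zero_mem_gr M.zero_mem_gr)
  have "additive d" and hom: "\<And>x \<alpha> n. x \<in> grS \<alpha> \<Longrightarrow> coeff (d x) n \<in> grS (\<alpha> + \<theta>)"
    using d by (simp_all only: conformal_linear_def clinear_poly_iff[OF SP.module_axioms SP.module_axioms])
  then have d0: "d 0 = 0" by (simp add: additive.zero)
  have lin: "conformal_linear sR grR sR grR \<theta> (d11 d)" "conformal_linear sR grR sM grM \<theta> (d21 d)"
    unfolding component_simps
    by (rule conformal_linear_components[where i = "\<lambda>r. (r, 0)" and s = sS and gr = grS and t = sR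
          and grt = grR, OF d SP.module_axioms R.module_axioms];
        simp add: R.module_axioms M.module_axioms additive_inl additive_fst additive_snd sd_scale_def
          sd_grade_def M.zero_mem_gr mem_Times_iff)+
  have RR: "(\<forall>\<alpha> \<beta>. \<forall>r\<in>grR \<alpha>. \<forall>r'\<in>grR \<beta>. derivation_at sS sB d (\<alpha> * \<theta>) (r, 0) (r', 0)) \<longleftrightarrow>
      conformal_derivation sR grR br \<theta> (d11 d) \<and> conformal_derivation_into sR grR br sM grM rho \<theta> (d21 d)"
  proof -
    have "derivation_at sS sB d (\<alpha> * \<theta>) (r, 0) (r', 0) \<longleftrightarrow>
        derivation_at sR br (d11 d) (\<alpha> * \<theta>) r r' \<and>
        app2 sM L2 (d21 d) (in_mu (br r r')) =
          ksgn (\<alpha> * \<theta>) (app2 sM M2 (rho r) (in_lam (d21 d r')))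
          - ksgn ((\<alpha> + \<theta>) * \<beta>) (app2 sM (- D2 - L2 - M2) (rho r') (in_lam (d21 d r)))"
      if "r \<in> grR \<alpha>" "r' \<in> grR \<beta>" for \<alpha> \<beta> r r'
      \<comment> \<open>Here \<gamma> is \<alpha> + \<theta>, the degree of the coefficients of
        \<open>d (r, 0)\<close>.\<close>
      by (rule derivation_at_RR[where d = d, OF d0 that(2) hom[OF gr(1)[OF that(1) M.zero_mem_gr]]])
    then show ?thesis
      unfolding derivation_R_iff[OF lin(1)] conformal_derivation_into_def using lin(2) by blast
  qed
  have MM: "derivation_at sS sB d (\<alpha> * \<theta>) (0, m) (0, m') \<longleftrightarrow>
      app2 sM (L2 + M2) (\<lambda>r. rho r m') (in_lam (d12 d m)) =
        ksgn (\<alpha> * \<beta>) (app2 sM (- D2 - M2) (\<lambda>r. rho r m) (in_lam (d12 d m')))"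
    if "m \<in> grM \<alpha>" "m' \<in> grM \<beta>" for \<alpha> \<beta> m m'
    by (rule derivation_at_MM[where d = d, OF d0 that(1) hom[OF gr(2)[OF R.zero_mem_gr that(2)]]])
  show ?thesis
    unfolding derivation_iff[OF d] RR derivation_at_RM[where d = d, OF d0] mult.commute[of \<theta>]
    using MM by blast
qed

end
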